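(* Fix $p>0$. For $r>0$ let $\rho_{\mathrm B,r}\in\mathscr C^0(\mathbb R)$ denote the density on $\mathbb R$ proportional to $x\mapsto\exp(-|x|^r)$. Consider the Cauchy problem $$\begin{cases}\partial_t\rho(t,x)+\partial_x\big((|x|\log x_+)_+\,\rho(t,x)\big)=0&\text{in }\mathbb R_{>0}\times\mathbb R,\\ \rho(0,x)=\rho_{\mathrm B,p}(x)&\text{in }\mathbb R.\end{cases}$$ Then for every $q\in(0,p]$ there exists a time $T_q>0$ such that the unique weak solution $\rho$ of this problem satisfies $$\lim_{x\to+\infty}\frac{\rho(T_q,x)}{\rho_{\mathrm B,q}(x)}<+\infty .$$
   Context: Here $s_+=(s)_+=\max\{s,0\}$, and the vector field $x\mapsto(|x|\log x_+)_+$ is understood to equal $x\log x$ for $x>1$ and $0$ for $x\leq1$. It is locally Lipschitz and its flow is globally defined; the unique weak solution is the one given by the method of characteristics, i.e. $\rho(t,\cdot)$ is the density of the pushforward of $\rho_{\mathrm B,p}(x)\,\mathrm dx$ under the time-$t$ flow map of $\dot x=(|x|\log x_+)_+$.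
   Formalization: For q = p the claim with T_p > 0 is false (the ratio tends to +∞ for every t > 0), so the formal statement asks for T_q > 0 only when q < p and for T_p ≥ 0 when q = p. *)

theory Defs
  imports "HOL-Analysis.Analysis"
begin

definition rhoB :: "real \<Rightarrow> real \<Rightarrow> real" where
  "rhoB r x = exp (- (\<bar>x\<bar> powr r)) / (LBINT y. exp (- (\<bar>y\<bar> powr r)))"

text \<open>The vector field \<open>x \<mapsto> (|x| log x\<^sub>+)\<^sub>+\<close>, with its value for \<open>x \<le> 1\<close> spelled out.\<close>

definition vfield :: "real \<Rightarrow> real" where
  "vfield x = (if 1 < x then x * ln x else 0)"

definition is_flow :: "(real \<Rightarrow> real) \<Rightarrow> (real \<Rightarrow> real \<Rightarrow> real) \<Rightarrow> bool" where
  "is_flow b \<Phi> \<longleftrightarrow>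
     (\<forall>x. \<Phi> 0 x = x) \<and>
     (\<forall>x t. ((\<lambda>s. \<Phi> s x) has_real_derivative b (\<Phi> t x)) (at t))"

definition prob_density :: "(real \<Rightarrow> real) \<Rightarrow> bool" where
  "prob_density f \<longleftrightarrow> (\<forall>x. 0 \<le> f x) \<and> integrable lborel f \<and> (LBINT x. f x) = 1"

definition test_function :: "(real \<Rightarrow> real) \<Rightarrow> bool" where
  "test_function \<phi> \<longleftrightarrow> \<phi> C1_differentiable_on UNIV \<and> compact (closure {x. \<phi> x \<noteq> 0})"

text \<open>
  Weak solutions of \<open>\<partial>\<^sub>t \<rho> + \<partial>\<^sub>x (b \<rho>) = 0\<close>, \<open>\<rho>(0) = \<rho>0\<close> among curves of probability
  densities: for every test function the map \<open>t \<mapsto> \<integral> \<phi> \<rho>(t)\<close> is absolutely continuous, with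
  initial value \<open>\<integral> \<phi> \<rho>0\<close> and with derivative \<open>\<integral> b \<phi>' \<rho>(t)\<close> for almost every \<open>t\<close>, stated here
  in integrated form. This makes \<open>t \<mapsto> \<rho>(t) dx\<close> narrowly continuous, so that \<open>\<rho>(t)\<close> is
  meaningful (up to null sets in \<open>x\<close>) at every single time \<open>t \<ge> 0\<close>. Values at \<open>t < 0\<close> are
  irrelevant.

  Since \<open>\<rho>(t)\<close> is only determined up to null sets, a pointwise limit of \<open>\<rho>(t,x)\<close> as
  \<open>x \<rightarrow> +\<infinity>\<close> needs a choice of representative; the one meant is continuous on \<open>(1,\<infinity>)\<close>,
  which determines all its values there. (At \<open>x = 1\<close> the solution has a jump when \<open>t > 0\<close>.)\<close>

definition weak_solution ::
  "(real \<Rightarrow> real) \<Rightarrow> (real \<Rightarrow> real) \<Rightarrow> (real \<Rightarrow> real \<Rightarrow> real) \<Rightarrow> bool" where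
  "weak_solution b \<rho>0 \<rho> \<longleftrightarrow>
     (\<forall>t\<ge>0. prob_density (\<rho> t)) \<and>
     (\<forall>\<phi>. test_function \<phi> \<longrightarrow> (\<forall>t\<ge>0.
        set_integrable lborel {0..t} (\<lambda>s. LBINT x. b x * deriv \<phi> x * \<rho> s x) \<and>
        (LBINT x. \<phi> x * \<rho> t x) =
          (LBINT x. \<phi> x * \<rho>0 x) + (LBINT s:{0..t}. LBINT x. b x * deriv \<phi> x * \<rho> s x)))"

definition unique_weak_solution ::
  "(real \<Rightarrow> real) \<Rightarrow> (real \<Rightarrow> real) \<Rightarrow> (real \<Rightarrow> real \<Rightarrow> real) \<Rightarrow> bool" where
  "unique_weak_solution b \<rho>0 \<rho> \<longleftrightarrow>
     weak_solution b \<rho>0 \<rho> \<and>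
     (\<forall>\<sigma>. weak_solution b \<rho>0 \<sigma> \<longrightarrow> (\<forall>t\<ge>0. AE x in lborel. \<sigma> t x = \<rho> t x))"

definition given_by_characteristics ::
  "(real \<Rightarrow> real) \<Rightarrow> (real \<Rightarrow> real) \<Rightarrow> (real \<Rightarrow> real \<Rightarrow> real) \<Rightarrow> bool" where
  "given_by_characteristics b \<rho>0 \<rho> \<longleftrightarrow>
     (\<exists>\<Phi>. is_flow b \<Phi> \<and> (\<forall>t\<ge>0.
        \<Phi> t \<in> borel_measurable borel \<and>
        density lborel (\<lambda>x. ennreal (\<rho> t x)) =
          distr (density lborel (\<lambda>x. ennreal (\<rho>0 x))) borel (\<Phi> t)))"

end

theory Submission
  imports Defs "HOL-Probability.Sinc_Integral"
begin

text \<open>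
  The flow is the identity on \<open>x \<le> 1\<close> and \<open>x \<mapsto> x powr exp t\<close> on \<open>x > 1\<close>, so the solution is
  \<open>\<rho>(t,x) = \<rho>\<^sub>0(y) y exp(-t) / x\<close> with \<open>y = x powr exp(-t)\<close> there. The tail
  \<open>exp (- (x powr p))\<close> becomes \<open>exp (- (x powr (p exp(-t))))\<close>, and at \<open>T = ln (p / q)\<close> the ratio to
  \<open>\<rho>\<^bsub>B,q\<^esub>\<close> is a multiple of \<open>x powr (q / p - 1)\<close>, which is bounded since \<open>q \<le> p\<close>. Uniqueness is
  by duality: pulling test functions back along the flow pairs \<open>\<sigma>(T)\<close> with \<open>\<psi>\<close> as \<open>\<rho>\<^sub>0\<close> with
  \<open>\<psi> \<circ> \<Phi>\<^sub>T\<close>, and test functions that are flat at \<open>1\<close>, where the flow has a corner, suffice to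
  determine a density.
\<close>

section \<open>The densities \<open>rhoB r\<close>: integrability, normalisation, continuity\<close>

lemma integrable_exp_powr:
  fixes r :: real
  assumes "r > 0"
  shows "integrable lborel (\<lambda>x::real. exp (- (\<bar>x\<bar> powr r)))"
proof -
  \<comment> \<open>The integrand is dominated by a multiple of the Cauchy density. With
    \<open>u = \<bar>x\<bar> powr r\<close>, this choice of \<open>n\<close> gives
    \<open>x\<^sup>2 \<le> u ^ n\<close> outside the unit interval, so a bound on
    \<open>exp (- u) * u ^ n\<close> suffices.\<close>
  obtain n :: nat where n: "real n * r \<ge> 2"
    using real_arch_simple[of "2 / r"] assms by (auto simp: field_simps)
  then have "n \<noteq> 0" using assms by (intro notI) auto
  define c where "c = 2 * (real n ^ n + 1)"
  have "set_integrable lborel UNIV (\<lambda>x::real. inverse (1 + x\<^sup>2))"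
    using integrable_inverse_1_plus_square by simp
  then have I: "integrable lborel (\<lambda>x::real. c * inverse (1 + x\<^sup>2))"
    by (intro integrable_mult_right) (simp add: set_integrable_def)
  show ?thesis
  proof (rule Bochner_Integration.integrable_bound[OF I])
    show "AE x in lborel. norm (exp (- (\<bar>x\<bar> powr r))) \<le> norm (c * inverse (1 + x\<^sup>2))"
    proof (rule AE_I2)
      fix x :: real
      have pos: "1 + x\<^sup>2 > 0" by (simp add: add_pos_nonneg)
      have cpos: "c > 0" by (simp add: c_def add_nonneg_pos)
      have le: "exp (- (\<bar>x\<bar> powr r)) * (1 + x\<^sup>2) \<le> c"
      proof (cases "\<bar>x\<bar> \<le> 1")
        case True
        then have "x\<^sup>2 \<le> 1" by (simp add: abs_square_le_1)
        then have "exp (- (\<bar>x\<bar> powr r)) * (1 + x\<^sup>2) \<le> 1 * 2"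
          by (intro mult_mono) auto
        also have "\<dots> \<le> c" by (simp add: c_def)
        finally show ?thesis .
      next
        case False
        then have x1: "\<bar>x\<bar> > 1" by simp
        define u where "u = \<bar>x\<bar> powr r"
        have u0: "u > 0" using x1 by (simp add: u_def)
        have "x\<^sup>2 = \<bar>x\<bar> powr 2" using x1 by simp
        also have "\<dots> \<le> \<bar>x\<bar> powr (real n * r)"
          using x1 n by (intro powr_mono) auto
        also have "\<dots> = u ^ n"
          using x1 by (simp add: u_def powr_power mult.commute)
        finally have xu: "x\<^sup>2 \<le> u ^ n" .
        \<comment> \<open>Applying \<open>y \<le> exp y\<close> to \<open>u / n\<close> and raising
          to the power \<open>n\<close> yields the explicit constant \<open>real n ^ n\<close> that
          enters \<open>c\<close>.\<close>
        have "(u / n) ^ n \<le> exp (u / n) ^ n"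
          using u0 exp_ge_add_one_self[of "u / n"] by (intro power_mono) (linarith, simp)
        also have "\<dots> = exp u" using \<open>n \<noteq> 0\<close> by (simp flip: exp_of_nat_mult)
        finally have "u ^ n \<le> real n ^ n * exp u"
          using \<open>n \<noteq> 0\<close> by (simp add: power_divide field_simps)
        with xu have "x\<^sup>2 \<le> real n ^ n * exp u" by linarith
        then have "exp (- u) * x\<^sup>2 \<le> exp (- u) * (real n ^ n * exp u)"
          by (intro mult_left_mono) auto
        also have "\<dots> = real n ^ n" by (simp add: exp_minus field_simps)
        finally have "exp (- u) * x\<^sup>2 \<le> real n ^ n" .
        moreover have "exp (- u) \<le> 1" using u0 by simp
        moreover have "0 \<le> real n ^ n" by simp
        ultimately show ?thesis unfolding u_def[symmetric] c_def
          unfolding distrib_left mult_1_right by linarith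
      qed
      then show "norm (exp (- (\<bar>x\<bar> powr r))) \<le> norm (c * inverse (1 + x\<^sup>2))"
        using pos cpos by (simp add: field_simps abs_mult)
    qed
  qed simp
qed

lemma prob_density_rhoB:
  assumes "r > 0"
  shows "prob_density (rhoB r)"
proof -
  let ?f = "\<lambda>x::real. exp (- (\<bar>x\<bar> powr r))"
  have I: "integrable lborel ?f" by (rule integrable_exp_powr[OF assms])
  \<comment> \<open>A vanishing integral would force the nonnegative integrand to be zero almost
    everywhere, but it is strictly positive.\<close>
  have "integral\<^sup>L lborel ?f \<noteq> 0"
    using integral_nonneg_eq_0_iff_AE[OF I] by (simp add: eventually_False ae_filter_eq_bot_iff)
  moreover have "integral\<^sup>L lborel ?f \<ge> 0" by simp
  moreover have "integrable lborel (rhoB r)"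
    unfolding rhoB_def using I by simp
  moreover have "integral\<^sup>L lborel (rhoB r) = integral\<^sup>L lborel ?f / integral\<^sup>L lborel ?f"
    unfolding rhoB_def by simp
  ultimately show ?thesis
    unfolding prob_density_def by (simp add: rhoB_def)
qed

lemma continuous_on_rhoB:
  assumes "r > 0"
  shows "continuous_on A (rhoB r)"
  \<comment> \<open>A zero normaliser would make the quotient identically zero by the convention on
    division, so both cases are continuous.\<close>
  unfolding rhoB_def using assms
  by (cases "integral\<^sup>L lborel (\<lambda>x::real. exp (- (\<bar>x\<bar> powr r))) = 0")
     (auto intro!: continuous_intros continuous_on_powr')

section \<open>The flow and the pushforward density\<close>

text \<open>For \<open>x > 1\<close> the ODE reads \<open>(ln ln x)' = 1\<close>, so the flow is \<open>x \<mapsto> x powr exp t\<close>.\<close>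

definition loglin_flow :: "real \<Rightarrow> real \<Rightarrow> real" where
  "loglin_flow t x = (if x \<le> 1 then x else exp (exp t * ln x))"

lemma loglin_flow_gt_1: "1 < x \<Longrightarrow> 1 < loglin_flow t x"
  by (simp add: loglin_flow_def)

lemma loglin_flow_le_1: "x \<le> 1 \<Longrightarrow> loglin_flow t x = x"
  by (simp add: loglin_flow_def)

lemma loglin_flow_0 [simp]: "loglin_flow 0 x = x"
  by (simp add: loglin_flow_def)

lemma loglin_flow_add: "loglin_flow s (loglin_flow t x) = loglin_flow (s + t) x"
proof (cases "x \<le> 1")
  case False
  then have "loglin_flow s (loglin_flow t x) = exp (exp s * ln (loglin_flow t x))"
    using loglin_flow_gt_1[of x t] unfolding loglin_flow_def[of s] by simp
  with False show ?thesis by (simp add: loglin_flow_def exp_add mult_ac)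
qed (simp add: loglin_flow_le_1)

lemma loglin_flow_measurable [measurable (raw)]:
  assumes [measurable]: "f \<in> borel_measurable M" "g \<in> borel_measurable M"
  shows "(\<lambda>x. loglin_flow (f x) (g x)) \<in> borel_measurable M"
  unfolding loglin_flow_def by measurable

lemma continuous_on_vfield: "continuous_on A vfield"
proof -
  \<comment> \<open>Truncating the argument at 1 replaces the case distinction, since
    \<open>1 * ln 1 = 0\<close>.\<close>
  have "continuous_on A (\<lambda>x::real. max 1 x * ln (max 1 x))"
    by (intro continuous_intros) (auto simp: max_def)
  then show ?thesis by (rule continuous_on_eq) (auto simp: vfield_def max_def)
qed

lemma is_flow_loglin_flow: "is_flow vfield loglin_flow"
proof -
  have "((\<lambda>s. loglin_flow s x) has_real_derivative vfield (loglin_flow t x)) (at t)" for x t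
    unfolding loglin_flow_def vfield_def
    by (cases "x \<le> 1") (auto intro!: derivative_eq_intros)
  then show ?thesis by (simp add: is_flow_def)
qed

lemma DERIV_loglin_flow_time:
  "((\<lambda>s. loglin_flow s x) has_real_derivative vfield (loglin_flow t x)) (at t)"
  using is_flow_loglin_flow by (simp add: is_flow_def)

text \<open>The point 1 is excluded: there the slope is 1 from the left and \<open>exp t\<close>
  from the right.\<close>

lemma DERIV_loglin_flow_space:
  assumes "1 < x"
  shows "(loglin_flow t has_real_derivative exp t * loglin_flow t x / x) (at x)"
proof -
  have "((\<lambda>x. exp (exp t * ln x)) has_real_derivative exp t * loglin_flow t x / x) (at x)"
    using assms by (auto intro!: derivative_eq_intros simp: loglin_flow_def)
  moreover have "\<forall>\<^sub>F y in nhds x. exp (exp t * ln y) = loglin_flow t y"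
    using eventually_nhds_in_open[of "{1<..}" x] assms
    by (auto simp: loglin_flow_def elim!: eventually_mono)
  ultimately show ?thesis by (subst (asm) DERIV_cong_ev) auto
qed

text \<open>This is the change-of-variables formula: for \<open>1 < x\<close> the second factor is
  the derivative at \<open>x\<close> of the inverse flow map \<open>loglin_flow (- t)\<close>, and
  for \<open>x \<le> 1\<close> that map is the identity. The value at 1, where the two branches may
  disagree, is taken from the left.\<close>

definition loglin_density :: "(real \<Rightarrow> real) \<Rightarrow> real \<Rightarrow> real \<Rightarrow> real" where
  "loglin_density f t x = (if x \<le> 1 then f x else
     f (loglin_flow (- t) x) * (exp (- t) * loglin_flow (- t) x / x))"

lemma loglin_density_nonneg: "(\<And>x. 0 \<le> f x) \<Longrightarrow> 0 \<le> loglin_density f t x"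
  using loglin_flow_gt_1[of x "-t"] by (auto simp: loglin_density_def)

lemma loglin_density_measurable [measurable]:
  assumes [measurable]: "f \<in> borel_measurable borel"
  shows "loglin_density f t \<in> borel_measurable borel"
  unfolding loglin_density_def by measurable

lemma continuous_on_loglin_density:
  assumes "continuous_on UNIV f"
  shows "continuous_on {1<..} (loglin_density f t)"
proof -
  have "continuous_on {1<..} (\<lambda>x. f (exp (exp (- t) * ln x)) * (exp (- t) * exp (exp (- t) * ln x) / x))"
    by (intro continuous_intros continuous_on_compose2[OF assms]) auto
  then show ?thesis
    by (rule continuous_on_eq) (simp add: loglin_density_def loglin_flow_def)
qed

lemma loglin_flow_image: "loglin_flow t ` {1<..} = {1<..}"
proof -
  have "x \<in> loglin_flow t ` {1<..}" if "1 < x" for x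
    using that loglin_flow_gt_1[of x "-t"] loglin_flow_add[of t "-t" x]
    by (intro image_eqI[of _ _ "loglin_flow (- t) x"]) auto
  then show ?thesis using loglin_flow_gt_1 by auto
qed

lemma inj_loglin_flow: "inj (loglin_flow t)"
  by (rule inj_on_inverseI[of _ "loglin_flow (- t)"]) (simp add: loglin_flow_add)

text \<open>The line is split at 1. To the left nothing moves; to the right the flow map is a smooth
  bijection of \<open>{1<..}\<close> and the substitution rule applies. Keeping an arbitrary set
  \<open>A\<close> makes this the pushforward identity of measures.\<close>

lemma nn_integral_loglin_density:
  fixes f g :: "real \<Rightarrow> real"
  assumes f: "integrable lborel f" "\<And>x. 0 \<le> f x" and A [measurable]: "A \<in> sets borel"
  shows "(\<integral>\<^sup>+x. ennreal (loglin_density f t x) * indicator A x \<partial>lborel) =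
    (\<integral>\<^sup>+x. ennreal (f x) * indicator A (loglin_flow t x) \<partial>lborel)"
proof -
  have [measurable]: "f \<in> borel_measurable borel"
    using f(1) by simp
  let ?S = "{1<..} :: real set"
  let ?g = "loglin_flow (- t)"
  define F where "F x = f x * indicator A (loglin_flow t x)" for x
  define G where "G x = exp (- t) * ?g x / x * F (?g x)" for x
  have [measurable]: "F \<in> borel_measurable borel" "G \<in> borel_measurable borel"
    unfolding F_def[abs_def] G_def[abs_def] by measurable
  have F0: "0 \<le> F x" for x using f(2) by (simp add: F_def)
  have G0: "0 \<le> G x" if "1 < x" for x
    using that loglin_flow_gt_1[of x "- t"] F0 by (simp add: G_def)
  have abs: "\<bar>exp (- t) * ?g x / x\<bar> = exp (- t) * ?g x / x" if "x \<in> ?S" for x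
    using that loglin_flow_gt_1[of x "- t"] by (simp add: abs_mult abs_divide)
  have "integrable lborel F"
    by (rule Bochner_Integration.integrable_bound[OF f(1)])
       (auto simp: F_def f(2) split: split_indicator)
  then have FB: "set_integrable lborel ?S F"
    unfolding set_integrable_def by (intro integrable_mult_indicator) auto
  \<comment> \<open>The substitution theorem is about absolute integrability for the completed
    Lebesgue measure; the transfer from \<open>lborel\<close> is made here and undone at
    \<open>GB\<close>.\<close>
  then have FI: "F absolutely_integrable_on ?S"
    by (auto simp: set_integrable_def intro: integrable_completion[THEN iffD2])
  let ?b = "integral ?S F"
  \<comment> \<open>Substitution by the inverse flow map \<open>?g\<close>, which is injective and
    maps \<open>{1<..}\<close> onto itself.\<close>
  have *: "(\<lambda>x. \<bar>exp (- t) * ?g x / x\<bar> * F (?g x)) absolutely_integrable_on ?S \<and>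
        integral ?S (\<lambda>x. \<bar>exp (- t) * ?g x / x\<bar> * F (?g x)) = ?b"
    by (subst has_absolute_integral_change_of_variables_1')
       (use FI inj_loglin_flow in \<open>auto simp: loglin_flow_image intro: inj_on_subset
          intro!: has_field_derivative_at_within[OF DERIV_loglin_flow_space]\<close>)
  have GI: "G absolutely_integrable_on ?S \<and> integral ?S G = ?b"
  proof -
    have eq: "\<bar>exp (- t) * ?g x / x\<bar> * F (?g x) = G x" if "x \<in> ?S" for x
      using abs[OF that] by (simp add: G_def)
    have "(\<lambda>x. \<bar>exp (- t) * ?g x / x\<bar> * F (?g x)) absolutely_integrable_on ?S \<longleftrightarrow>
        G absolutely_integrable_on ?S"
      by (intro set_integrable_cong eq refl)
    moreover have "integral ?S (\<lambda>x. \<bar>exp (- t) * ?g x / x\<bar> * F (?g x)) = integral ?S G"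
      by (intro Henstock_Kurzweil_Integration.integral_cong eq)
    ultimately show ?thesis using * by simp
  qed
  then have GB: "set_integrable lborel ?S G"
    by (simp add: set_integrable_def integrable_completion)
  have nn: "(\<integral>\<^sup>+x. ennreal (H x) * indicator ?S x \<partial>lborel) = ennreal (integral ?S H)"
    if "set_integrable lborel ?S H" "\<And>x. 1 < x \<Longrightarrow> 0 \<le> H x" for H
  proof -
    have "(\<integral>\<^sup>+x. ennreal (H x) * indicator ?S x \<partial>lborel) = (\<integral>\<^sup>+x. ennreal (indicator ?S x *\<^sub>R H x) \<partial>lborel)"
      by (intro nn_integral_cong) (auto split: split_indicator)
    also have "\<dots> = ennreal (\<integral>x. indicator ?S x *\<^sub>R H x \<partial>lborel)"
      using that by (intro nn_integral_eq_integral) (auto simp: set_integrable_def split: split_indicator)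
    also have "\<dots> = ennreal (integral ?S H)"
      using set_borel_integral_eq_integral(2)[OF that(1)] by (simp add: set_lebesgue_integral_def)
    finally show ?thesis .
  qed
  have main: "(\<integral>\<^sup>+x. ennreal (G x) * indicator ?S x \<partial>lborel) = (\<integral>\<^sup>+x. ennreal (F x) * indicator ?S x \<partial>lborel)"
    using nn[OF GB G0] nn[OF FB F0] GI by simp
  have split: "(\<integral>\<^sup>+x. u x \<partial>lborel) = (\<integral>\<^sup>+x. u x * indicator {..1} x \<partial>lborel) + (\<integral>\<^sup>+x. u x * indicator ?S x \<partial>lborel)"
    if [measurable]: "u \<in> borel_measurable borel" for u :: "real \<Rightarrow> ennreal"
    by (subst nn_integral_add[symmetric]) (auto intro!: nn_integral_cong split: split_indicator)
  \<comment> \<open>Below 1 the integrand is already \<open>F\<close>. Above 1,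
    \<open>loglin_flow t (?g x) = x\<close> turns the indicator inside \<open>F (?g x)\<close> into
    that of \<open>A\<close> at \<open>x\<close>.\<close>
  have "(\<integral>\<^sup>+x. ennreal (loglin_density f t x) * indicator A x \<partial>lborel) =
      (\<integral>\<^sup>+x. ennreal (F x) * indicator {..1} x \<partial>lborel) + (\<integral>\<^sup>+x. ennreal (G x) * indicator ?S x \<partial>lborel)"
    by (subst split)
       (auto intro!: arg_cong2[of _ _ _ _ "(+)"] nn_integral_cong split: split_indicator
         simp: F_def G_def loglin_density_def loglin_flow_le_1 loglin_flow_add mult_ac)
  also have "\<dots> = (\<integral>\<^sup>+x. ennreal (F x) \<partial>lborel)"
    by (subst split[of "\<lambda>x. ennreal (F x)"]) (simp_all add: main)
  also have "\<dots> = (\<integral>\<^sup>+x. ennreal (f x) * indicator A (loglin_flow t x) \<partial>lborel)"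
    by (intro nn_integral_cong) (auto simp: F_def split: split_indicator)
  finally show ?thesis .
qed

lemma density_loglin_density:
  fixes f :: "real \<Rightarrow> real"
  assumes f: "integrable lborel f" "\<And>x. 0 \<le> f x"
  shows "density lborel (\<lambda>x. ennreal (loglin_density f t x)) =
    distr (density lborel (\<lambda>x. ennreal (f x))) borel (loglin_flow t)"
proof (rule measure_eqI)
  have [measurable]: "f \<in> borel_measurable borel"
    using f(1) by simp
  fix A assume "A \<in> sets (density lborel (\<lambda>x. ennreal (loglin_density f t x)))"
  then have [measurable]: "A \<in> sets borel" by simp
  have [measurable]: "loglin_flow t -` A \<in> sets borel"
    using measurable_sets_borel[of "loglin_flow t" borel A] by simp
  show "emeasure (density lborel (\<lambda>x. ennreal (loglin_density f t x))) A =
      emeasure (distr (density lborel (\<lambda>x. ennreal (f x))) borel (loglin_flow t)) A"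
    by (simp add: emeasure_distr emeasure_density nn_integral_loglin_density[OF f] indicator_vimage)
qed simp

lemma continuous_on_of_DERIV:
  fixes f :: "real \<Rightarrow> real"
  assumes "\<And>x. (f has_real_derivative f' x) (at x)"
  shows "continuous_on A f"
  by (rule DERIV_continuous_on) (rule has_field_derivative_at_within[OF assms])

section \<open>Existence\<close>

lemma integral_loglin_density:
  fixes f u :: "real \<Rightarrow> real"
  assumes f: "integrable lborel f" "\<And>x. 0 \<le> f x" and [measurable]: "u \<in> borel_measurable borel"
  shows "(LBINT x. u x * loglin_density f t x) =
    integral\<^sup>L (density lborel (\<lambda>x. ennreal (f x))) (\<lambda>x. u (loglin_flow t x))"
proof -
  have [measurable]: "f \<in> borel_measurable borel"
    using f(1) by simp
  have "(LBINT x. u x * loglin_density f t x) =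
      integral\<^sup>L (density lborel (\<lambda>x. ennreal (loglin_density f t x))) u"
    using loglin_density_nonneg[OF f(2)] by (subst integral_density) (auto simp: mult.commute)
  also have "\<dots> = integral\<^sup>L (density lborel (\<lambda>x. ennreal (f x))) (\<lambda>x. u (loglin_flow t x))"
    unfolding density_loglin_density[OF f] by (subst integral_distr) auto
  finally show ?thesis .
qed

lemma prob_density_loglin_density:
  assumes "prob_density f"
  shows "prob_density (loglin_density f t)"
proof -
  have f: "integrable lborel f" "\<And>x. 0 \<le> f x" "integral\<^sup>L lborel f = 1"
    using assms by (auto simp: prob_density_def)
  have [measurable]: "f \<in> borel_measurable borel"
    using f(1) by simp
  have "(\<integral>\<^sup>+x. ennreal (loglin_density f t x) \<partial>lborel) = (\<integral>\<^sup>+x. ennreal (f x) \<partial>lborel)"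
    using nn_integral_loglin_density[OF f(1,2), of UNIV t] by simp
  also have "\<dots> = 1"
    using f by (subst nn_integral_eq_integral) auto
  finally have nn: "(\<integral>\<^sup>+x. ennreal (loglin_density f t x) \<partial>lborel) = 1" .
  have "integrable lborel (loglin_density f t)"
    using nn loglin_density_nonneg[OF f(2)] by (intro integrableI_nonneg) auto
  moreover have "integral\<^sup>L lborel (loglin_density f t) = 1"
    using nn loglin_density_nonneg[OF f(2)] by (subst integral_eq_nn_integral) auto
  ultimately show ?thesis
    using loglin_density_nonneg[OF f(2)] by (simp add: prob_density_def)
qed

section \<open>Compactly supported functions and test functions\<close>

lemma bounded_of_compact_support:
  fixes f :: "real \<Rightarrow> real"
  assumes "continuous_on UNIV f" "\<And>x. R < \<bar>x\<bar> \<Longrightarrow> f x = 0"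
  obtains B where "0 \<le> B" "\<And>x. \<bar>f x\<bar> \<le> B"
proof -
  have "bounded (f ` {- R..R})"
    by (intro compact_imp_bounded compact_continuous_image continuous_on_subset[OF assms(1)]) auto
  then obtain B where B: "B > 0" "\<forall>x\<in>{- R..R}. \<bar>f x\<bar> \<le> B"
    unfolding bounded_pos by auto
  have "\<bar>f x\<bar> \<le> B" for x
    using B assms(2)[of x] by (cases "\<bar>x\<bar> \<le> R") (auto simp: abs_le_iff)
  with B(1) show ?thesis by (intro that[of B]) auto
qed

lemma DERIV_zero_outside:
  fixes f :: "real \<Rightarrow> real"
  assumes "\<And>x. R < \<bar>x\<bar> \<Longrightarrow> f x = 0" "(f has_real_derivative d) (at x)" "R < \<bar>x\<bar>"
  shows "d = 0"
proof -
  have "open {y. R < \<bar>y::real\<bar>}" by (intro open_Collect_less continuous_intros)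
  then have "(f has_real_derivative 0) (at x)"
    using assms(1,3)
    by (intro has_field_derivative_transform_within_open[of "\<lambda>_. 0" 0 x "{y. R < \<bar>y\<bar>}" f]) auto
  with assms(2) show ?thesis by (rule DERIV_unique)
qed

lemma test_functionD:
  assumes "test_function \<phi>"
  shows "(\<phi> has_real_derivative deriv \<phi> x) (at x)"
    and "continuous_on UNIV (deriv \<phi>)"
    and "\<exists>R. \<forall>x. R < \<bar>x\<bar> \<longrightarrow> \<phi> x = 0"
proof -
  obtain D where D: "\<And>x. (\<phi> has_real_derivative D x) (at x)" "continuous_on UNIV D"
    using assms unfolding test_function_def C1_differentiable_on_def
    by (auto simp: has_real_derivative_iff_has_vector_derivative)
  have "deriv \<phi> = D"
    using D(1) by (auto intro: DERIV_imp_deriv)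
  with D show "(\<phi> has_real_derivative deriv \<phi> x) (at x)" "continuous_on UNIV (deriv \<phi>)"
    by auto
  have "bounded {x. \<phi> x \<noteq> 0}"
    using assms unfolding test_function_def
    by (meson bounded_subset closure_subset compact_imp_bounded)
  then obtain R where "\<forall>x\<in>{x. \<phi> x \<noteq> 0}. norm x \<le> R"
    unfolding bounded_iff by blast
  then show "\<exists>R. \<forall>x. R < \<bar>x\<bar> \<longrightarrow> \<phi> x = 0"
    by (intro exI[of _ R]) (auto simp: not_le[symmetric])
qed

lemma test_functionI:
  assumes "\<And>x. (\<phi> has_real_derivative \<phi>' x) (at x)" "continuous_on UNIV \<phi>'"
    "\<And>x. R < \<bar>x\<bar> \<Longrightarrow> \<phi> x = 0"
  shows "test_function \<phi>"
proof -
  have "closure {x. \<phi> x \<noteq> 0} \<subseteq> {- R..R}"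
    using assms(3) by (intro closure_minimal) (auto simp: abs_le_iff not_less[symmetric])
  then have "compact (closure {x. \<phi> x \<noteq> 0})"
    by (meson bounded_closed_interval bounded_subset closed_closure compact_eq_bounded_closed)
  moreover have "\<phi> C1_differentiable_on UNIV"
    using assms(1,2) unfolding C1_differentiable_on_def
    by (auto simp: has_real_derivative_iff_has_vector_derivative)
  ultimately show ?thesis by (simp add: test_function_def)
qed

text \<open>Along each characteristic, \<open>\<phi> (loglin_flow s x)\<close> has time derivative
  \<open>w (loglin_flow s x)\<close>. Integrating in \<open>s\<close>, then against
  \<open>f\<close>, and exchanging the integrals by Fubini gives the weak formulation. Only time
  derivatives of the flow occur, so its corner in space is harmless here.\<close>

lemma weak_solution_loglin_density:
  assumes "prob_density f"
  shows "weak_solution vfield f (loglin_density f)"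
proof -
  have f: "integrable lborel f" "\<And>x. 0 \<le> f x" "integral\<^sup>L lborel f = 1"
    using assms by (auto simp: prob_density_def)
  have [measurable]: "f \<in> borel_measurable borel"
    using f(1) by simp
  define M where "M = density lborel (\<lambda>x. ennreal (f x))"
  have [measurable_cong, simp]: "sets M = sets borel" and [simp]: "space M = UNIV"
    by (auto simp: M_def)
  have eM: "emeasure M UNIV = 1"
    using f by (simp add: M_def emeasure_density nn_integral_eq_integral)
  interpret M: prob_space M
    by (rule prob_spaceI) (simp add: eM)
  interpret LM: pair_sigma_finite lborel M ..
  have "set_integrable lborel {0..t} (\<lambda>s. LBINT x. vfield x * deriv \<phi> x * loglin_density f s x) \<and>
      (LBINT x. \<phi> x * loglin_density f t x) = (LBINT x. \<phi> x * f x) +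
        (LBINT s:{0..t}. LBINT x. vfield x * deriv \<phi> x * loglin_density f s x)"
    if \<phi>: "test_function \<phi>" and t: "0 \<le> t" for \<phi> t
  proof -
    note \<phi>D = test_functionD(1,2)[OF \<phi>]
    obtain R where R: "\<And>x. R < \<bar>x\<bar> \<Longrightarrow> \<phi> x = 0" using test_functionD(3)[OF \<phi>] by auto
    define w where "w x = vfield x * deriv \<phi> x" for x
    have wc: "continuous_on UNIV w"
      unfolding w_def by (intro continuous_intros continuous_on_vfield \<phi>D(2))
    have \<phi>c: "continuous_on UNIV \<phi>"
      by (rule continuous_on_of_DERIV[OF \<phi>D(1)])
    have [measurable]: "w \<in> borel_measurable borel" "\<phi> \<in> borel_measurable borel"
      by (auto intro: borel_measurable_continuous_onI wc \<phi>c)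
    \<comment> \<open>The field itself is unbounded; \<open>w\<close> is bounded because the
      derivative of \<open>\<phi>\<close> has compact support.\<close>
    have "w x = 0" if "R < \<bar>x\<bar>" for x
      using DERIV_zero_outside[OF R \<phi>D(1) that] by (simp add: w_def)
    then obtain B where B: "0 \<le> B" "\<And>x. \<bar>w x\<bar> \<le> B"
      using bounded_of_compact_support[OF wc] by blast
    obtain C where C: "\<And>x. \<bar>\<phi> x\<bar> \<le> C"
      using bounded_of_compact_support[OF \<phi>c R] by blast
    have intM: "integrable M (\<lambda>x. \<phi> (loglin_flow s x))" for s
      by (rule M.integrable_const_bound[of _ C]) (auto simp: C)
    have F: "(LBINT x. vfield x * deriv \<phi> x * loglin_density f s x) =
        (\<integral>x. w (loglin_flow s x) \<partial>M)" for s
      unfolding M_def w_def[symmetric] by (rule integral_loglin_density[OF f(1,2)]) simp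
    \<comment> \<open>The time cutoff makes Fubini applicable: \<open>h\<close> is bounded by
      \<open>B\<close> and lives on a set of measure \<open>t\<close> in the product space.\<close>
    define h where "h s x = indicator {0..t} s * w (loglin_flow s x)" for s x
    have emA: "emeasure (lborel \<Otimes>\<^sub>M M) ({0..t} \<times> UNIV) = ennreal t"
      using t by (subst M.emeasure_pair_measure_Times) (auto simp: eM)
    have hint: "integrable (lborel \<Otimes>\<^sub>M M) (\<lambda>(s, x). h s x)"
      by (rule integrableI_bounded_set[where A = "{0..t} \<times> UNIV" and B = B])
         (auto intro!: AE_I2 simp: h_def emA B indicator_def)
    have ftc: "(\<integral>s. h s x \<partial>lborel) = \<phi> (loglin_flow t x) - \<phi> x" for x
    proof -
      have "(\<integral>s. indicator {0..t} s *\<^sub>R w (loglin_flow s x) \<partial>lborel) =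
          \<phi> (loglin_flow t x) - \<phi> (loglin_flow 0 x)"
      proof (rule integral_FTC_atLeastAtMost[OF t])
        show "((\<lambda>s. \<phi> (loglin_flow s x)) has_vector_derivative w (loglin_flow s x)) (at s within {0..t})" for s
        proof -
          have "((\<lambda>s. \<phi> (loglin_flow s x)) has_real_derivative w (loglin_flow s x)) (at s)"
            unfolding w_def mult.commute[of "vfield _"]
            by (rule DERIV_chain2[OF \<phi>D(1) DERIV_loglin_flow_time])
          then show ?thesis
            unfolding has_real_derivative_iff_has_vector_derivative
            by (rule has_vector_derivative_at_within)
        qed
        have "continuous_on {0..t} (\<lambda>s. loglin_flow s x)"
          by (rule continuous_on_of_DERIV[OF DERIV_loglin_flow_time])
        then show "continuous_on {0..t} (\<lambda>s. w (loglin_flow s x))"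
          by (intro continuous_on_compose2[OF wc]) auto
      qed
      then show ?thesis by (simp add: h_def)
    qed
    have "integrable lborel (\<lambda>s. \<integral>x. h s x \<partial>M)"
      using LM.integrable_fst'[OF hint] by simp
    then have "set_integrable lborel {0..t} (\<lambda>s. \<integral>x. w (loglin_flow s x) \<partial>M)"
      by (simp add: set_integrable_def h_def)
    moreover have "(LBINT x. \<phi> x * loglin_density f t x) = (LBINT x. \<phi> x * f x) +
        (LBINT s:{0..t}. \<integral>x. w (loglin_flow s x) \<partial>M)"
    proof -
      have "(LBINT s:{0..t}. \<integral>x. w (loglin_flow s x) \<partial>M) = (\<integral>s. (\<integral>x. h s x \<partial>M) \<partial>lborel)"
        by (simp add: set_lebesgue_integral_def h_def)
      also have "\<dots> = (\<integral>x. (\<integral>s. h s x \<partial>lborel) \<partial>M)"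
        by (rule LM.Fubini_integral[OF hint, symmetric])
      also have "\<dots> = (\<integral>x. \<phi> (loglin_flow t x) \<partial>M) - (\<integral>x. \<phi> x \<partial>M)"
        unfolding ftc using intM[of t] intM[of 0] by (subst Bochner_Integration.integral_diff) auto
      also have "(\<integral>x. \<phi> x \<partial>M) = (LBINT x. \<phi> x * f x)"
        unfolding M_def using f(2) by (subst integral_density) (auto simp: mult.commute)
      also have "(\<integral>x. \<phi> (loglin_flow t x) \<partial>M) = (LBINT x. \<phi> x * loglin_density f t x)"
        unfolding M_def by (rule integral_loglin_density[OF f(1,2), symmetric]) simp
      finally show ?thesis by simp
    qed
    ultimately show ?thesis unfolding F by simp
  qed
  then show ?thesis
    using prob_density_loglin_density[OF assms] by (simp add: weak_solution_def)
qed

section \<open>Uniqueness\<close>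

text \<open>Matching values and slopes at \<open>c\<close> suffice for a \<open>C^1\<close>
  function. This serves every function below that changes its formula at one point: compositions
  with the flow, products with the field, and powers of a positive part.\<close>

lemma C1_glue:
  fixes f g :: "real \<Rightarrow> real"
  assumes f: "\<And>x. x \<le> c \<Longrightarrow> (f has_real_derivative f' x) (at x)"
    and g: "\<And>x. c \<le> x \<Longrightarrow> (g has_real_derivative g' x) (at x)"
    and eq: "f c = g c" "f' c = g' c"
    and cont: "continuous_on {..c} f'" "continuous_on {c..} g'"
  shows "((\<lambda>x. if x \<le> c then f x else g x) has_real_derivative (if x \<le> c then f' x else g' x)) (at x)"
    and "continuous_on UNIV (\<lambda>x. if x \<le> c then f' x else g' x)"
proof -
  have "((\<lambda>x. if x \<in> {..c} then f x else g x) has_vector_derivative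
      (if x \<in> {..c} then f' x else g' x)) (at x within UNIV)"
  proof (rule has_vector_derivative_If_within_closures[of x "{..c}" "{c<..}" UNIV])
    show "(f has_vector_derivative f' x) (at x within {..c} \<union> (closure {..c} \<inter> closure {c<..}))"
      if "x \<in> {..c} \<union> (closure {..c} \<inter> closure {c<..})"
      using that f[of x]
      by (auto simp: has_real_derivative_iff_has_vector_derivative intro: has_vector_derivative_at_within)
    show "(g has_vector_derivative g' x) (at x within {c<..} \<union> (closure {..c} \<inter> closure {c<..}))"
      if "x \<in> {c<..} \<union> (closure {..c} \<inter> closure {c<..})"
      using that g[of x]
      by (auto simp: has_real_derivative_iff_has_vector_derivative intro: has_vector_derivative_at_within)
    have "x = c" if "x \<in> closure {..c}" "x \<in> closure {c<..}" using that by auto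
    then show "f x = g x" "f' x = g' x" if "x \<in> closure {..c}" "x \<in> closure {c<..}"
      using that eq by auto
  qed auto
  then show "((\<lambda>x. if x \<le> c then f x else g x) has_real_derivative (if x \<le> c then f' x else g' x)) (at x)"
    by (simp add: has_real_derivative_iff_has_vector_derivative)
  show "continuous_on UNIV (\<lambda>x. if x \<le> c then f' x else g' x)"
    by (rule continuous_on_cases_le)
       (use cont eq in \<open>auto simp: atMost_def atLeast_def intro: continuous_intros\<close>)
qed

text \<open>The flow map has a corner at \<open>1\<close>. Test functions whose derivative vanishes there stay
  \<open>C\<^sup>1\<close> under composition with the flow.\<close>

definition flat_test :: "(real \<Rightarrow> real) \<Rightarrow> bool" where
  "flat_test \<eta> \<longleftrightarrow> test_function \<eta> \<and> deriv \<eta> 1 = 0"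

lemma flat_testI:
  assumes "\<And>x. (\<eta> has_real_derivative \<eta>' x) (at x)" "continuous_on UNIV \<eta>'" "\<eta>' 1 = 0"
    "\<And>x. R < \<bar>x\<bar> \<Longrightarrow> \<eta> x = 0"
  shows "flat_test \<eta>"
  using test_functionI[OF assms(1,2,4)] DERIV_imp_deriv[OF assms(1), of 1] assms(3)
  by (simp add: flat_test_def)

lemma flat_testD:
  assumes "flat_test \<eta>"
  shows "(\<eta> has_real_derivative deriv \<eta> x) (at x)"
    and "continuous_on UNIV (deriv \<eta>)" "deriv \<eta> 1 = 0"
    and "\<exists>R. \<forall>x. R < \<bar>x\<bar> \<longrightarrow> \<eta> x = 0"
  using assms test_functionD[of \<eta>] by (auto simp: flat_test_def)

section \<open>Pulling flat test functions back along the flow\<close>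

lemma loglin_flow_mono:
  assumes "1 < x" "x < y"
  shows "loglin_flow t x < loglin_flow t y"
  using assms by (simp add: loglin_flow_def)

text \<open>At 1 both one-sided slopes of the composition are multiples of
  \<open>deriv \<eta> 1 = 0\<close>, so the corner disappears. The second claim reflects that a
  field is invariant under its own flow: for \<open>1 < x\<close>, the space derivative of the flow
  times \<open>x * ln x\<close> is the field at \<open>loglin_flow t x\<close>.\<close>

lemma flat_test_flow:
  assumes "flat_test \<eta>"
  shows "flat_test (\<lambda>x. \<eta> (loglin_flow t x))"
    and "vfield x * deriv (\<lambda>x. \<eta> (loglin_flow t x)) x =
           vfield (loglin_flow t x) * deriv \<eta> (loglin_flow t x)"
proof -
  note \<eta> = flat_testD[OF assms]
  let ?e = "\<lambda>x. exp (exp t * ln x)"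
  let ?g = "\<lambda>x. deriv \<eta> (?e x) * (exp t * ?e x / x)"
  let ?D = "\<lambda>x. if x \<le> 1 then deriv \<eta> x else ?g x"
  have eq: "(\<lambda>x. if x \<le> 1 then \<eta> x else \<eta> (?e x)) = (\<lambda>x. \<eta> (loglin_flow t x))"
    by (auto simp: loglin_flow_def)
  have g: "((\<lambda>x. \<eta> (?e x)) has_real_derivative ?g x) (at x)" if "1 \<le> x" for x
    using that by (intro DERIV_chain2[OF \<eta>(1)]) (auto intro!: derivative_eq_intros)
  have gc: "continuous_on {1..} ?g"
    by (intro continuous_intros continuous_on_compose2[OF \<eta>(2)]) auto
  have D: "((\<lambda>x. \<eta> (loglin_flow t x)) has_real_derivative ?D x) (at x)"
    and Dc: "continuous_on UNIV ?D" for x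
    using C1_glue[of 1 \<eta> "deriv \<eta>" "\<lambda>x. \<eta> (?e x)" ?g] \<eta>(1,3) g gc
      continuous_on_subset[OF \<eta>(2), of "{..1}"]
    unfolding eq by auto
  obtain R where R: "\<And>x. R < \<bar>x\<bar> \<Longrightarrow> \<eta> x = 0" using \<eta>(4) by auto
  \<comment> \<open>Points above 1 leave the support once they exceed the backward image of
    \<open>R\<close>; \<open>max R 2\<close> keeps that image in the region where the flow map is
    strictly increasing. The term \<open>\<bar>R\<bar>\<close> covers the points that do not
    move.\<close>
  define R' where "R' = max \<bar>R\<bar> (loglin_flow (- t) (max R 2))"
  have "1 < max R 2" by simp
  then have "1 < R'" using loglin_flow_gt_1[of "max R 2" "- t"] by (simp add: R'_def less_max_iff_disj)
  have "\<eta> (loglin_flow t x) = 0" if x: "R' < \<bar>x\<bar>" for x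
  proof (cases "x \<le> 1")
    case True
    with x show ?thesis by (intro R) (auto simp: loglin_flow_le_1 R'_def)
  next
    case False
    then have "loglin_flow t (loglin_flow (- t) (max R 2)) < loglin_flow t x"
      using x loglin_flow_gt_1[of "max R 2" "- t"] by (intro loglin_flow_mono) (auto simp: R'_def)
    then show ?thesis by (intro R) (simp add: loglin_flow_add)
  qed
  with D Dc \<eta>(3) show "flat_test (\<lambda>x. \<eta> (loglin_flow t x))"
    by (intro flat_testI[of _ ?D R']) auto
  show "vfield x * deriv (\<lambda>x. \<eta> (loglin_flow t x)) x =
      vfield (loglin_flow t x) * deriv \<eta> (loglin_flow t x)"
    unfolding DERIV_imp_deriv[OF D]
    using loglin_flow_gt_1[of x t] by (auto simp: vfield_def loglin_flow_def)
qed

lemma flat_test_transport_bounded: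
  assumes "flat_test \<eta>"
  obtains B where "0 \<le> B" "\<And>x. \<bar>vfield x * deriv \<eta> x\<bar> \<le> B"
proof -
  note \<eta> = flat_testD[OF assms]
  obtain R where R: "\<And>x. R < \<bar>x\<bar> \<Longrightarrow> \<eta> x = 0" using \<eta>(4) by auto
  show ?thesis
    by (rule bounded_of_compact_support[of "\<lambda>x. vfield x * deriv \<eta> x" R])
       (use DERIV_zero_outside[OF R \<eta>(1)] that
         in \<open>auto intro!: continuous_intros continuous_on_vfield \<eta>(2)\<close>)
qed

lemma flat_test_measurable:
  assumes "flat_test \<eta>"
  shows "\<eta> \<in> borel_measurable borel" "(\<lambda>x. vfield x * deriv \<eta> x) \<in> borel_measurable borel"
proof -
  have "continuous_on UNIV \<eta>"
    by (rule continuous_on_of_DERIV[OF flat_testD(1)[OF assms]])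
  then show "\<eta> \<in> borel_measurable borel" by (rule borel_measurable_continuous_onI)
  show "(\<lambda>x. vfield x * deriv \<eta> x) \<in> borel_measurable borel"
    by (intro borel_measurable_continuous_onI continuous_intros continuous_on_vfield flat_testD(2)[OF assms])
qed

lemma flat_test_bounded:
  assumes "flat_test \<eta>"
  obtains B where "\<And>x. \<bar>\<eta> x\<bar> \<le> B"
proof -
  note \<eta> = flat_testD[OF assms]
  obtain R where R: "\<And>x. R < \<bar>x\<bar> \<Longrightarrow> \<eta> x = 0" using \<eta>(4) by auto
  have "continuous_on UNIV \<eta>"
    by (rule continuous_on_of_DERIV[OF \<eta>(1)])
  then show ?thesis by (rule bounded_of_compact_support[of \<eta> R]) (use R that in auto)
qed

section \<open>Estimates for the duality argument\<close>

lemma prob_density_integral_bound: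
  assumes "prob_density f" and [measurable]: "u \<in> borel_measurable borel" and B: "\<And>x. \<bar>u x\<bar> \<le> B"
  shows "integrable lborel (\<lambda>x. u x * f x)" "\<bar>LBINT x. u x * f x\<bar> \<le> B"
proof -
  have f: "integrable lborel f" "\<And>x. 0 \<le> f x" "integral\<^sup>L lborel f = 1"
    using assms by (auto simp: prob_density_def)
  have [measurable]: "f \<in> borel_measurable borel"
    using f(1) by simp
  have B0: "0 \<le> B" using B[of 0] by linarith
  have le: "\<bar>u x * f x\<bar> \<le> B * f x" for x
    using B[of x] f(2)[of x] by (simp add: abs_mult mult_right_mono)
  show I: "integrable lborel (\<lambda>x. u x * f x)"
    by (rule Bochner_Integration.integrable_bound[of _ "\<lambda>x. B * f x"]) (use f B0 le in auto)
  have "\<bar>LBINT x. u x * f x\<bar> \<le> (LBINT x. B * f x)"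
    by (rule order.trans[OF integral_abs_bound integral_mono]) (use I f le in auto)
  also have "\<dots> = B" using f by simp
  finally show "\<bar>LBINT x. u x * f x\<bar> \<le> B" .
qed

text \<open>The difference quotients at \<open>s\<close> are at most
  \<open>C * \<bar>r - s\<bar>\<close> in absolute value, so the derivative vanishes everywhere on
  the interval.\<close>

lemma constant_of_quadratic_modulus:
  fixes g :: "real \<Rightarrow> real"
  assumes "\<And>s r. 0 \<le> s \<Longrightarrow> s \<le> r \<Longrightarrow> r \<le> T \<Longrightarrow> \<bar>g r - g s\<bar> \<le> C * (r - s)\<^sup>2" "0 \<le> T"
  shows "g T = g 0"
proof -
  have sym: "\<bar>g r - g s\<bar> \<le> C * (r - s)\<^sup>2" if "s \<in> {0..T}" "r \<in> {0..T}" for s r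
    using assms(1)[of s r] assms(1)[of r s] that
    by (cases "s \<le> r") (auto simp: abs_minus_commute power2_commute)
  have "\<exists>c. \<forall>x\<in>{0..T}. g x = c"
  proof (rule has_field_derivative_zero_constant)
    fix s assume s: "s \<in> {0..T}"
    show "(g has_real_derivative 0) (at s within {0..T})"
      unfolding has_field_derivative_iff
    proof (rule Lim_null_comparison)
      show "\<forall>\<^sub>F r in at s within {0..T}. norm ((g r - g s) / (r - s)) \<le> C * \<bar>r - s\<bar>"
        unfolding eventually_at_filter
      proof (intro always_eventually allI impI)
        fix r assume r: "r \<noteq> s" "r \<in> {0..T}"
        have "\<bar>g r - g s\<bar> \<le> C * \<bar>r - s\<bar> * \<bar>r - s\<bar>"
          using sym[OF s r(2)] by (simp add: power2_eq_square abs_mult[symmetric] mult.assoc)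
        with r show "norm ((g r - g s) / (r - s)) \<le> C * \<bar>r - s\<bar>"
          by (simp add: field_simps)
      qed
      show "((\<lambda>r. C * \<bar>r - s\<bar>) \<longlongrightarrow> 0) (at s within {0..T})"
        by (auto intro!: tendsto_eq_intros)
    qed
  qed auto
  then show ?thesis using assms(2) by auto
qed

text \<open>Along a trajectory, \<open>\<zeta>\<close> is the first and
  \<open>vfield x * \<zeta>' x\<close> the second time derivative of \<open>\<eta>\<close>. Two
  applications of the mean value inequality bound the first-order remainder uniformly in
  \<open>x\<close>, so that the bound survives integration against a probability density.\<close>

lemma flow_taylor:
  assumes \<eta>: "\<And>x. (\<eta> has_real_derivative \<eta>' x) (at x)"
    and \<zeta>: "\<And>x. (\<zeta> has_real_derivative \<zeta>' x) (at x)"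
    and \<zeta>_eq: "\<And>x. \<zeta> x = vfield x * \<eta>' x"
    and B: "\<And>x. \<bar>vfield x * \<zeta>' x\<bar> \<le> B"
  shows "\<bar>\<eta> (loglin_flow (t - h) x) - \<eta> (loglin_flow t x) + h * \<zeta> (loglin_flow t x)\<bar> \<le> B * h\<^sup>2"
proof -
  have d1: "((\<lambda>a. \<eta> (loglin_flow a x)) has_real_derivative \<zeta> (loglin_flow a x)) (at a)" for a
    using DERIV_chain2[OF \<eta> DERIV_loglin_flow_time, of x a] by (simp add: \<zeta>_eq mult.commute)
  have d2: "((\<lambda>a. \<zeta> (loglin_flow a x)) has_real_derivative
      vfield (loglin_flow a x) * \<zeta>' (loglin_flow a x)) (at a)" for a
    using DERIV_chain2[OF \<zeta> DERIV_loglin_flow_time, of x a] by (simp add: mult.commute)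
  have lip: "\<bar>\<zeta> (loglin_flow a x) - \<zeta> (loglin_flow b x)\<bar> \<le> B * \<bar>a - b\<bar>" for a b
    using field_differentiable_bound[OF convex_UNIV d2, of B a b] B by simp
  \<comment> \<open>Subtracting the linear part leaves a function whose derivative is
    \<open>\<zeta>\<close> minus its value at time \<open>t\<close>, which \<open>lip\<close>
    controls.\<close>
  let ?k = "\<lambda>a. \<eta> (loglin_flow a x) - a * \<zeta> (loglin_flow t x)"
  have "norm (?k (t - h) - ?k t) \<le> (B * \<bar>h\<bar>) * norm ((t - h) - t)"
  proof (rule field_differentiable_bound[of "closed_segment t (t - h)"])
    fix a assume a: "a \<in> closed_segment t (t - h)"
    show "(?k has_real_derivative \<zeta> (loglin_flow a x) - \<zeta> (loglin_flow t x))
        (at a within closed_segment t (t - h))"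
      by (auto intro!: derivative_eq_intros has_field_derivative_at_within[OF d1])
    have "\<bar>a - t\<bar> \<le> \<bar>h\<bar>" using a by (auto simp: closed_segment_eq_real_ivl split: if_splits)
    moreover have "0 \<le> B" using B[of 0] by linarith
    ultimately show "norm (\<zeta> (loglin_flow a x) - \<zeta> (loglin_flow t x)) \<le> B * \<bar>h\<bar>"
      using lip[of a t] by (smt (verit) mult_left_mono real_norm_def)
  qed auto
  then show ?thesis by (simp add: algebra_simps power2_eq_square abs_mult[symmetric])
qed

lemma weak_solution_increment:
  assumes ws: "weak_solution vfield f \<sigma>" and \<eta>: "test_function \<eta>" and sr: "0 \<le> s" "s \<le> r"
  shows "((\<lambda>z. LBINT x. vfield x * deriv \<eta> x * \<sigma> z x) has_integral
    (LBINT x. \<eta> x * \<sigma> r x) - (LBINT x. \<eta> x * \<sigma> s x)) {s..r}"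
proof -
  let ?F = "\<lambda>z. LBINT x. vfield x * deriv \<eta> x * \<sigma> z x"
  have I: "set_integrable lborel {0..t} ?F" "(LBINT x. \<eta> x * \<sigma> t x) =
      (LBINT x. \<eta> x * f x) + integral {0..t} ?F" if "0 \<le> t" for t
  proof -
    show int: "set_integrable lborel {0..t} ?F"
      using ws \<eta> that by (auto simp: weak_solution_def)
    show "(LBINT x. \<eta> x * \<sigma> t x) = (LBINT x. \<eta> x * f x) + integral {0..t} ?F"
      using ws \<eta> that set_borel_integral_eq_integral(2)[OF int] by (simp add: weak_solution_def)
  qed
  have r0: "?F integrable_on {0..r}"
    using set_borel_integral_eq_integral(1)[OF I(1)] sr by auto
  have "integral {0..s} ?F + integral {s..r} ?F = integral {0..r} ?F"
    by (rule Henstock_Kurzweil_Integration.integral_combine[OF sr r0])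
  moreover have "?F integrable_on {s..r}"
    by (rule integrable_subinterval_real[OF r0]) (use sr in auto)
  ultimately show ?thesis
    using I(2)[of s] I(2)[of r] sr by (simp add: has_integral_iff)
qed

text \<open>The duality argument: \<open>g s = \<integral> \<eta> (\<Phi>\<^bsub>T-s\<^esub> x) \<sigma>(s,x) dx\<close> is constant. As both \<open>\<eta>\<close> and its transport
  derivative \<open>\<zeta> = b \<eta>'\<close> are test functions, the first-order terms coming from the change of \<open>\<sigma>\<close> and of the
  flow cancel up to \<open>O((r - s)\<^sup>2)\<close>, without any time-dependent test functions.\<close>

lemma weak_solution_transport:
  assumes ws: "weak_solution vfield f \<sigma>" and \<eta>: "flat_test \<eta>"
    and \<zeta>: "flat_test \<zeta>" and \<zeta>_eq: "\<And>x. \<zeta> x = vfield x * deriv \<eta> x" and T: "0 \<le> T"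
  shows "(LBINT x. \<eta> x * \<sigma> T x) = (LBINT x. \<eta> (loglin_flow T x) * f x)"
proof -
  define m where "m s u = (LBINT x. u x * \<sigma> s x)" for s and u :: "real \<Rightarrow> real"
  obtain B where B: "0 \<le> B" "\<And>x. \<bar>vfield x * deriv \<zeta> x\<bar> \<le> B"
    using flat_test_transport_bounded[OF \<zeta>] by blast
  have pd: "prob_density (\<sigma> s)" if "0 \<le> s" for s
    using ws that by (simp add: weak_solution_def)
  define P where "P t u = (\<lambda>x. u (loglin_flow t x))" for t and u :: "real \<Rightarrow> real"
  have flat: "flat_test (P t \<eta>)" "flat_test (P t \<zeta>)" for t
    using flat_test_flow(1)[OF \<eta>] flat_test_flow(1)[OF \<zeta>] by (simp_all add: P_def)
  have D1: "vfield x * deriv (P t \<eta>) x = P t \<zeta> x" for t x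
    using flat_test_flow(2)[OF \<eta>] by (simp add: P_def \<zeta>_eq)
  \<comment> \<open>Since pullback commutes with the transport derivative, the bound
    \<open>B\<close> for \<open>\<zeta>\<close> holds for all its pullbacks, uniformly in
    \<open>t\<close>.\<close>
  have D2: "\<bar>vfield x * deriv (P t \<zeta>) x\<bar> \<le> B" for t x
    using flat_test_flow(2)[OF \<zeta>, of x t] B(2) by (simp add: P_def)
  have inc: "((\<lambda>z. LBINT x. vfield x * deriv \<theta> x * \<sigma> z x) has_integral m r \<theta> - m s \<theta>) {s..r}"
    if "flat_test \<theta>" "0 \<le> s" "s \<le> r" for \<theta> s r
    using weak_solution_increment[OF ws, of \<theta> s r] that by (simp add: m_def flat_test_def)
  have lip: "\<bar>m r (P t \<zeta>) - m s (P t \<zeta>)\<bar> \<le> B * (r - s)" if "0 \<le> s" "s \<le> r" for s r t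
  proof -
    have "norm (m r (P t \<zeta>) - m s (P t \<zeta>)) \<le> B * measure lborel {s..r}"
    proof (rule has_integral_bound_real[OF B(1) finite.emptyI])
      show "((\<lambda>z. LBINT x. vfield x * deriv (P t \<zeta>) x * \<sigma> z x) has_integral
          m r (P t \<zeta>) - m s (P t \<zeta>)) {s..r}"
        by (rule inc[OF flat(2) that])
      show "norm (LBINT x. vfield x * deriv (P t \<zeta>) x * \<sigma> z x) \<le> B" if "z \<in> {s..r} - {}" for z
        using prob_density_integral_bound(2)[OF pd flat_test_measurable(2)[OF flat(2)] D2, of z t] that \<open>0 \<le> s\<close>
        by simp
    qed
    with that show ?thesis by simp
  qed
  \<comment> \<open>Here the test function is frozen and the solution moves. The rate
    \<open>m z (P t \<zeta>)\<close> is replaced by its value at the right endpoint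
    \<open>r\<close>, at quadratic cost by \<open>lip\<close>.\<close>
  have time: "\<bar>m r (P t \<eta>) - m s (P t \<eta>) - (r - s) * m r (P t \<zeta>)\<bar> \<le> B * (r - s)\<^sup>2"
    if sr: "0 \<le> s" "s \<le> r" for s r t
  proof -
    have "((\<lambda>z. m z (P t \<zeta>)) has_integral m r (P t \<eta>) - m s (P t \<eta>)) {s..r}"
      using inc[OF flat(1)[of t] sr] unfolding D1 m_def .
    then have "((\<lambda>z. m z (P t \<zeta>) - m r (P t \<zeta>)) has_integral
        m r (P t \<eta>) - m s (P t \<eta>) - (r - s) * m r (P t \<zeta>)) {s..r}"
      using has_integral_const_real[of "m r (P t \<zeta>)" s r] sr
      by (intro has_integral_diff) auto
    then have "norm (m r (P t \<eta>) - m s (P t \<eta>) - (r - s) * m r (P t \<zeta>)) \<le>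
        (B * (r - s)) * measure lborel {s..r}"
    proof (rule has_integral_bound_real[OF _ finite.emptyI, rotated])
      show "norm (m z (P t \<zeta>) - m r (P t \<zeta>)) \<le> B * (r - s)" if z: "z \<in> {s..r} - {}" for z
      proof -
        have "\<bar>m r (P t \<zeta>) - m z (P t \<zeta>)\<bar> \<le> B * (r - z)" using lip[of z r t] z sr by simp
        also have "\<dots> \<le> B * (r - s)" using z B(1) by (intro mult_left_mono) auto
        finally show ?thesis by (simp add: abs_minus_commute)
      qed
    qed (use sr B(1) in auto)
    with sr show ?thesis by (simp add: power2_eq_square)
  qed
  \<comment> \<open>Here the solution is frozen at time \<open>r\<close> and the flow moves.\<close>
  have space: "\<bar>m r (P (t - h) \<eta>) - m r (P t \<eta>) + h * m r (P t \<zeta>)\<bar> \<le> B * h\<^sup>2"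
    if "0 \<le> r" for r t h
  proof -
    obtain C1 where C1: "\<And>x. \<bar>\<eta> x\<bar> \<le> C1" using flat_test_bounded[OF \<eta>] by blast
    obtain C2 where C2: "\<And>x. \<bar>\<zeta> x\<bar> \<le> C2" using flat_test_bounded[OF \<zeta>] by blast
    have i1: "integrable lborel (\<lambda>x. P t \<eta> x * \<sigma> r x)" for t
      by (rule prob_density_integral_bound(1)[OF pd[OF that] flat_test_measurable(1)[OF flat(1)], where B = C1])
         (simp add: P_def C1)
    have i2: "integrable lborel (\<lambda>x. P t \<zeta> x * \<sigma> r x)" for t
      by (rule prob_density_integral_bound(1)[OF pd[OF that] flat_test_measurable(1)[OF flat(2)], where B = C2])
         (simp add: P_def C2)
    let ?u = "\<lambda>x. P (t - h) \<eta> x - P t \<eta> x + h * P t \<zeta> x"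
    have "m r ?u = m r (P (t - h) \<eta>) - m r (P t \<eta>) + h * m r (P t \<zeta>)"
      using i1 i2 unfolding m_def by (simp add: algebra_simps)
    moreover have "\<bar>m r ?u\<bar> \<le> B * h\<^sup>2"
      unfolding m_def
    proof (rule prob_density_integral_bound(2)[OF pd[OF that]])
      have [measurable]: "P t \<eta> \<in> borel_measurable borel" "P t \<zeta> \<in> borel_measurable borel" for t
        using flat flat_test_measurable(1) by auto
      show "?u \<in> borel_measurable borel" by measurable
      show "\<bar>?u x\<bar> \<le> B * h\<^sup>2" for x
        unfolding P_def
        by (rule flow_taylor[OF flat_testD(1)[OF \<eta>] flat_testD(1)[OF \<zeta>] \<zeta>_eq B(2)])
    qed
    ultimately show ?thesis by simp
  qed
  define g where "g s = m s (P (T - s) \<eta>)" for s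
  have "g T = g 0"
  proof (rule constant_of_quadratic_modulus[of T g "2 * B"])
    fix s r assume sr: "0 \<le> s" "s \<le> r" "r \<le> T"
    \<comment> \<open>With flow time \<open>T - s\<close> and step \<open>r - s\<close>, both
      estimates contain the same term \<open>(r - s) * m r (P (T - s) \<zeta>)\<close> with opposite
      signs. Adding them leaves \<open>g r - g s\<close>.\<close>
    have "T - s - (r - s) = T - r" by simp
    then show "\<bar>g r - g s\<bar> \<le> 2 * B * (r - s)\<^sup>2"
      using space[of r "T - s" "r - s"] time[of s r "T - s"] sr unfolding g_def by simp
  qed (rule T)
  moreover have "g T = (LBINT x. \<eta> x * \<sigma> T x)"
    by (simp add: g_def m_def P_def)
  moreover have "g 0 = (LBINT x. \<eta> (loglin_flow T x) * f x)"
  proof -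
    \<comment> \<open>Only the weak formulation at time 0 links \<open>\<sigma> 0\<close> to
      \<open>f\<close>; its time integral is over a single point and vanishes.\<close>
    have "m 0 \<theta> = (LBINT x. \<theta> x * f x)" if "flat_test \<theta>" for \<theta>
    proof -
      have "m 0 \<theta> = (LBINT x. \<theta> x * f x) +
          (LBINT s:{0..0}. LBINT x. vfield x * deriv \<theta> x * \<sigma> s x)"
        using ws that by (simp add: weak_solution_def flat_test_def m_def)
      then show ?thesis 
        using set_borel_integral_eq_integral(2)[of "{0..0}"
            "\<lambda>s. LBINT x. vfield x * deriv \<theta> x * \<sigma> s x"] ws that
        by (simp add: weak_solution_def flat_test_def)
    qed
    then show ?thesis using flat(1) by (simp add: g_def P_def)
  qed
  ultimately show ?thesis by simp
qed

section \<open>\<open>C^2\<close> cutoffs that are flat at 1, and densities determined by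
  them\<close>

definition C2 :: "(real \<Rightarrow> real) \<Rightarrow> bool" where
  "C2 f \<longleftrightarrow> (\<exists>f' f''. (\<forall>x. (f has_real_derivative f' x) (at x)) \<and>
     (\<forall>x. (f' has_real_derivative f'' x) (at x)) \<and> continuous_on UNIV f'')"

lemma C2I:
  assumes "\<And>x. (f has_real_derivative f' x) (at x)" "\<And>x. (f' has_real_derivative f'' x) (at x)"
    "continuous_on UNIV f''"
  shows "C2 f"
  using assms unfolding C2_def by blast

lemma C2_affine: "C2 (\<lambda>x. a * x + b)"
  by (rule C2I[of _ "\<lambda>_. a" "\<lambda>_. 0"]) (auto intro!: derivative_eq_intros)

lemma C2_mult:
  assumes "C2 f" "C2 g"
  shows "C2 (\<lambda>x. f x * g x)"
proof -
  obtain f' f'' where f: "\<And>x. (f has_real_derivative f' x) (at x)"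
    "\<And>x. (f' has_real_derivative f'' x) (at x)" "continuous_on UNIV f''"
    using assms(1) unfolding C2_def by blast
  obtain g' g'' where g: "\<And>x. (g has_real_derivative g' x) (at x)"
    "\<And>x. (g' has_real_derivative g'' x) (at x)" "continuous_on UNIV g''"
    using assms(2) unfolding C2_def by blast
  show ?thesis
    by (rule C2I[of _ "\<lambda>x. f' x * g x + f x * g' x" "\<lambda>x. f'' x * g x + 2 * f' x * g' x + f x * g'' x"])
       (auto intro!: derivative_eq_intros f g continuous_intros
          continuous_on_of_DERIV[OF f(1)] continuous_on_of_DERIV[OF f(2)]
          continuous_on_of_DERIV[OF g(1)] continuous_on_of_DERIV[OF g(2)])
qed

lemma C2_compose:
  assumes "C2 f" "C2 g"
  shows "C2 (\<lambda>x. g (f x))"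
proof -
  obtain f' f'' where f: "\<And>x. (f has_real_derivative f' x) (at x)"
    "\<And>x. (f' has_real_derivative f'' x) (at x)" "continuous_on UNIV f''"
    using assms(1) unfolding C2_def by blast
  obtain g' g'' where g: "\<And>x. (g has_real_derivative g' x) (at x)"
    "\<And>x. (g' has_real_derivative g'' x) (at x)" "continuous_on UNIV g''"
    using assms(2) unfolding C2_def by blast
  show ?thesis
  proof (rule C2I[of _ "\<lambda>x. g' (f x) * f' x" "\<lambda>x. g'' (f x) * f' x * f' x + g' (f x) * f'' x"])
    show "((\<lambda>x. g (f x)) has_real_derivative g' (f x) * f' x) (at x)" for x
      by (rule DERIV_chain2[OF g(1) f(1)])
    show "((\<lambda>x. g' (f x) * f' x) has_real_derivative
        g'' (f x) * f' x * f' x + g' (f x) * f'' x) (at x)" for x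
      using DERIV_mult[OF DERIV_chain2[OF g(2) f(1)] f(2)] by (simp add: mult_ac add_ac)
    show "continuous_on UNIV (\<lambda>x. g'' (f x) * f' x * f' x + g' (f x) * f'' x)"
      by (intro continuous_intros f(3) continuous_on_of_DERIV[OF f(2)]
          continuous_on_compose2[OF g(3) continuous_on_of_DERIV[OF f(1)]]
          continuous_on_compose2[OF continuous_on_of_DERIV[OF g(2), of UNIV] continuous_on_of_DERIV[OF f(1)]]) auto
  qed
qed

text \<open>With exponent at least 2, both branches have value and slope zero at the origin, so they
  glue.\<close>

lemma DERIV_positive_part_power:
  "((\<lambda>x::real. max 0 x ^ Suc (Suc n)) has_real_derivative real (n + 2) * max 0 x ^ Suc n) (at x)"
proof -
  have "((\<lambda>x::real. x ^ Suc (Suc n)) has_real_derivative real (n + 2) * x ^ Suc n) (at x)" for x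
    using DERIV_pow[of "Suc (Suc n)" x] by simp
  then have "((\<lambda>x::real. if x \<le> 0 then 0 else x ^ Suc (Suc n)) has_real_derivative
      (if x \<le> 0 then 0 else real (n + 2) * x ^ Suc n)) (at x)"
    by (intro C1_glue(1)) (auto intro!: continuous_intros)
  moreover have "(\<lambda>x::real. if x \<le> 0 then 0 else x ^ Suc (Suc n)) = (\<lambda>x. max 0 x ^ Suc (Suc n))"
    by (auto simp: max_def)
  moreover have "(if x \<le> 0 then 0 else real (n + 2) * x ^ Suc n) = real (n + 2) * max 0 x ^ Suc n"
    by (auto simp: max_def)
  ultimately show ?thesis by simp
qed

text \<open>The cube is the lowest integer power of the positive part that is still
  \<open>C^2\<close>.\<close>

lemma C2_positive_part_cube: "C2 (\<lambda>x. max 0 x ^ 3)"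
proof (rule C2I[of _ "\<lambda>x. 3 * max 0 x ^ 2" "\<lambda>x. 3 * (2 * max 0 x)"])
  show "((\<lambda>x. max 0 x ^ 3) has_real_derivative 3 * max 0 x ^ 2) (at x)" for x :: real
    using DERIV_positive_part_power[of 1 x] by (simp add: numeral_eq_Suc)
  show "((\<lambda>x. 3 * max 0 x ^ 2) has_real_derivative 3 * (2 * max 0 x)) (at x)" for x :: real
    using DERIV_cmult[OF DERIV_positive_part_power[of 0 x], of 3] by (simp add: numeral_eq_Suc)
qed (intro continuous_intros)

text \<open>The map \<open>y \<mapsto> y / (1 + y)\<close> sends 0 to 0, stays below 1 and tends to
  1 at infinity; it turns nonnegative functions that blow up on a set into cutoffs converging to its
  indicator.\<close>

lemma C2_saturate:
  assumes "C2 f" "\<And>x. 0 \<le> f x"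
  shows "C2 (\<lambda>x. 1 - 1 / (1 + f x))"
proof -
  obtain f' f'' where f: "\<And>x. (f has_real_derivative f' x) (at x)"
    "\<And>x. (f' has_real_derivative f'' x) (at x)" "continuous_on UNIV f''"
    using assms(1) unfolding C2_def by blast
  have nz: "1 + f x \<noteq> 0" for x using assms(2)[of x] by linarith
  show ?thesis
  proof (rule C2I[of _ "\<lambda>x. f' x / (1 + f x)\<^sup>2"
        "\<lambda>x. f'' x / (1 + f x)\<^sup>2 - 2 * f' x * f' x / (1 + f x) ^ 3"])
    show "((\<lambda>x. 1 - 1 / (1 + f x)) has_real_derivative f' x / (1 + f x)\<^sup>2) (at x)" for x
      using nz[of x] by (auto intro!: derivative_eq_intros f simp: power2_eq_square)
    show "((\<lambda>x. f' x / (1 + f x)\<^sup>2) has_real_derivative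
        f'' x / (1 + f x)\<^sup>2 - 2 * f' x * f' x / (1 + f x) ^ 3) (at x)" for x
      using nz[of x]
      by (auto intro!: derivative_eq_intros f simp: divide_simps power2_eq_square power3_eq_cube)
        (simp add: algebra_simps)
    show "continuous_on UNIV (\<lambda>x. f'' x / (1 + f x)\<^sup>2 - 2 * f' x * f' x / (1 + f x) ^ 3)"
      using nz by (intro continuous_intros f(3) continuous_on_of_DERIV[OF f(2)]
          continuous_on_of_DERIV[OF f(1)]) auto
  qed
qed

text \<open>The transport derivative contains \<open>deriv \<psi>\<close> and must itself be
  \<open>C^1\<close>, which is why two derivatives of \<open>\<psi>\<close> are asked for. The field
  has one-sided slopes 0 and 1 at the point 1; the factor \<open>deriv \<psi> 1 = 0\<close> removes
  this corner and makes the product flat.\<close>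

lemma flat_test_of_C2:
  assumes "C2 \<psi>" "deriv \<psi> 1 = 0" and R: "\<And>x. R < \<bar>x\<bar> \<Longrightarrow> \<psi> x = 0"
  shows "flat_test \<psi>" "flat_test (\<lambda>x. vfield x * deriv \<psi> x)"
proof -
  obtain \<psi>' \<psi>'' where \<psi>: "\<And>x. (\<psi> has_real_derivative \<psi>' x) (at x)"
    "\<And>x. (\<psi>' has_real_derivative \<psi>'' x) (at x)" "continuous_on UNIV \<psi>''"
    using assms(1) unfolding C2_def by blast
  have d: "deriv \<psi> = \<psi>'" using \<psi>(1) by (auto intro: DERIV_imp_deriv)
  have c: "continuous_on A \<psi>'" for A by (rule continuous_on_of_DERIV[OF \<psi>(2)])
  show "flat_test \<psi>"
    using assms(2) by (intro flat_testI[OF \<psi>(1) c _ R]) (auto simp: d)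
  let ?D = "\<lambda>x. (ln x + 1) * \<psi>' x + x * ln x * \<psi>'' x"
  have eq: "(\<lambda>x. if x \<le> 1 then 0 else x * ln x * \<psi>' x) = (\<lambda>x. vfield x * \<psi>' x)"
    by (auto simp: vfield_def)
  have g: "((\<lambda>x. x * ln x * \<psi>' x) has_real_derivative ?D x) (at x)" if "1 \<le> x" for x
    using that by (auto intro!: derivative_eq_intros \<psi> simp: field_simps)
  have gc: "continuous_on {1..} ?D"
    by (intro continuous_intros continuous_on_subset[OF \<psi>(3)] c) auto
  have D: "((\<lambda>x. vfield x * \<psi>' x) has_real_derivative (if x \<le> 1 then 0 else ?D x)) (at x)"
    and Dc: "continuous_on UNIV (\<lambda>x. if x \<le> 1 then 0 else ?D x)" for x
    using C1_glue[of 1 "\<lambda>_. 0" "\<lambda>_. 0" "\<lambda>x. x * ln x * \<psi>' x" ?D] g gc assms(2)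
    unfolding eq d by auto
  show "flat_test (\<lambda>x. vfield x * deriv \<psi> x)"
    unfolding d
    by (rule flat_testI[OF D Dc, of R]) (use DERIV_zero_outside[OF R \<psi>(1)] in auto)
qed

text \<open>Half-lines determine a finite Borel measure, so their indicators are the limits to
  reach. The point 1, where the cutoffs vanish, is lost in the limit but is a null set.\<close>

lemma flat_cutoffs:
  fixes a :: real
  obtains \<psi> :: "nat \<Rightarrow> real \<Rightarrow> real"
  where "\<And>n. flat_test (\<psi> n)" "\<And>n. flat_test (\<lambda>x. vfield x * deriv (\<psi> n) x)"
    "\<And>n x. \<bar>\<psi> n x\<bar> \<le> 1" "\<And>x. (\<lambda>n. \<psi> n x) \<longlonglongrightarrow> indicator ({a<..} - {1}) x"
proof -
  \<comment> \<open>The factor \<open>(y - 1)\<^sup>2\<close> makes the cutoffs flat at the corner \<open>1\<close> of the flow.\<close>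
  define N where "N n y = max 0 (y - a) ^ 3 * max 0 (real n - y) ^ 3 * (real n * (y - 1)\<^sup>2)"
    for n :: nat and y :: real
  define \<psi> where "\<psi> n y = 1 - 1 / (1 + N n y)" for n y
  have N0: "0 \<le> N n y" for n y by (simp add: N_def)
  have C2N: "C2 (N n)" for n
  proof -
    have "C2 (\<lambda>y. max 0 (1 * y + (- a)) ^ 3 * max 0 ((-1) * y + real n) ^ 3 *
        ((real n * y + (- real n)) * (1 * y + (- 1))))"
      by (intro C2_mult C2_affine C2_compose[OF C2_affine C2_positive_part_cube])
    then show ?thesis
      by (rule back_subst[of C2]) (auto simp: N_def fun_eq_iff power2_eq_square algebra_simps)
  qed
  have C2\<psi>: "C2 (\<psi> n)" for n
    unfolding \<psi>_def by (rule C2_saturate[OF C2N N0])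
  have bnd: "0 \<le> \<psi> n y" "\<psi> n y \<le> 1" for n y
    using N0[of n y] by (auto simp: \<psi>_def divide_simps)
  have d1: "deriv (\<psi> n) 1 = 0" for n
  proof -
    obtain \<psi>' where \<psi>': "\<And>x. (\<psi> n has_real_derivative \<psi>' x) (at x)"
      using C2\<psi>[of n] unfolding C2_def by blast
    have "\<psi>' 1 = 0"
      \<comment> \<open>The cutoff is nonnegative and attains the value 0 at 1, so 1 is a
        minimum.\<close>
      by (rule DERIV_local_min[OF \<psi>'[of 1], of 1]) (use bnd in \<open>auto simp: \<psi>_def N_def\<close>)
    then show ?thesis using DERIV_imp_deriv[OF \<psi>'[of 1]] by simp
  qed
  have supp: "\<psi> n y = 0" if "max \<bar>a\<bar> (real n) < \<bar>y\<bar>" for n y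
  proof -
    have "y - a \<le> 0 \<or> real n - y \<le> 0" using that by (auto simp: abs_if split: if_splits)
    then have "N n y = 0" by (auto simp: N_def)
    then show ?thesis by (simp add: \<psi>_def)
  qed
  have lim: "(\<lambda>n. \<psi> n y) \<longlonglongrightarrow> indicator ({a<..} - {1}) y" for y
  proof (cases "y \<in> {a<..} - {1}")
    case False
    then have "N n y = 0" for n by (auto simp: N_def)
    then have "\<psi> n y = 0" for n by (simp add: \<psi>_def)
    with False show ?thesis by simp
  next
    case True
    define c where "c = (y - a) ^ 3 * (y - 1)\<^sup>2"
    have c: "0 < c" using True by (simp add: c_def)
    obtain n0 :: nat where n0: "y + 1 \<le> real n0" using real_arch_simple by blast
    \<comment> \<open>Once \<open>n \<ge> y + 1\<close> the factor \<open>(real n - y) ^ 3\<close>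
      is at least 1, and what remains grows linearly in \<open>n\<close>.\<close>
    have ev: "\<forall>\<^sub>F n in sequentially. c * real n \<le> N n y"
    proof (intro eventually_sequentiallyI[of n0])
      fix n assume "n0 \<le> n"
      then have n: "1 \<le> real n - y" using n0 by linarith
      have "c * real n * 1 \<le> c * real n * (real n - y) ^ 3"
        using c n by (intro mult_left_mono one_le_power) auto
      also have "\<dots> = N n y" using True n by (simp add: N_def c_def)
      finally show "c * real n \<le> N n y" by simp
    qed
    have "filterlim (\<lambda>n. c * real n) at_top sequentially"
      using c by (intro filterlim_tendsto_pos_mult_at_top[OF tendsto_const]) (auto intro: filterlim_real_sequentially)
    then have "filterlim (\<lambda>n. N n y) at_top sequentially"
      by (rule filterlim_at_top_mono[OF _ ev])
    then have "filterlim (\<lambda>n. 1 + N n y) at_top sequentially"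
      by (intro filterlim_tendsto_add_at_top[OF tendsto_const])
    then have "(\<lambda>n. 1 - inverse (1 + N n y)) \<longlonglongrightarrow> 1 - 0"
      by (intro tendsto_intros tendsto_inverse_0_at_top)
    with True show ?thesis by (simp add: \<psi>_def inverse_eq_divide)
  qed
  show ?thesis
  proof (rule that[of \<psi>])
    show "flat_test (\<psi> n)" for n
      using supp by (rule flat_test_of_C2(1)[OF C2\<psi> d1])
    show "flat_test (\<lambda>x. vfield x * deriv (\<psi> n) x)" for n
      using supp by (rule flat_test_of_C2(2)[OF C2\<psi> d1])
    show "\<bar>\<psi> n x\<bar> \<le> 1" for n x using bnd[of n x] by simp
  qed (rule lim)
qed

text \<open>Dominated convergence along \<open>flat_cutoffs\<close> shows that both densities give
  every half-line \<open>{a<..}\<close> the same mass, so the measures agree and the densities agree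
  almost everywhere.\<close>

lemma prob_density_eqI:
  assumes f: "prob_density f" and g: "prob_density g"
    and eq: "\<And>\<psi>. flat_test \<psi> \<Longrightarrow> flat_test (\<lambda>x. vfield x * deriv \<psi> x) \<Longrightarrow>
      (LBINT x. \<psi> x * f x) = (LBINT x. \<psi> x * g x)"
  shows "AE x in lborel. f x = g x"
proof -
  have fD: "integrable lborel f" "\<And>x. 0 \<le> f x" and gD: "integrable lborel g" "\<And>x. 0 \<le> g x"
    using f g by (auto simp: prob_density_def)
  have [measurable]: "f \<in> borel_measurable borel" "g \<in> borel_measurable borel"
    using fD(1) gD(1) by simp_all
  have tail: "emeasure (density lborel (\<lambda>x. ennreal (h x))) {a<..} =
      ennreal (LBINT x. indicator ({a<..} - {1}) x * h x)"
    if h: "integrable lborel h" "\<And>x. 0 \<le> h x" for h :: "real \<Rightarrow> real" and a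
  proof -
    have [measurable]: "h \<in> borel_measurable borel" using h(1) by simp
    have "emeasure (density lborel (\<lambda>x. ennreal (h x))) {a<..} =
        (\<integral>\<^sup>+x. ennreal (h x) * indicator {a<..} x \<partial>lborel)"
      by (simp add: emeasure_density)
    also have "\<dots> = (\<integral>\<^sup>+x. ennreal (indicator ({a<..} - {1}) x * h x) \<partial>lborel)"
    proof (rule nn_integral_cong_AE)
      have "AE x in lborel. x \<noteq> (1::real)" by (rule AE_lborel_singleton)
      then show "AE x in lborel. ennreal (h x) * indicator {a<..} x =
          ennreal (indicator ({a<..} - {1}) x * h x)"
        by eventually_elim (auto split: split_indicator)
    qed
    also have "\<dots> = ennreal (LBINT x. indicator ({a<..} - {1}) x * h x)"
    proof (rule nn_integral_eq_integral)
      show "integrable lborel (\<lambda>x. indicator ({a<..} - {1}) x * h x)"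
        using integrable_mult_indicator[OF _ h(1), of "{a<..} - {1}"] by simp
      show "AE x in lborel. 0 \<le> indicator ({a<..} - {1}) x * h x"
        by (intro AE_I2 mult_nonneg_nonneg h(2)) simp
    qed
    finally show ?thesis .
  qed
  have "(LBINT x. indicator ({a<..} - {1}) x * f x) = (LBINT x. indicator ({a<..} - {1}) x * g x)" for a :: real
  proof (rule flat_cutoffs[of a])
    fix \<psi> :: "nat \<Rightarrow> real \<Rightarrow> real"
    assume \<psi>: "\<And>n. flat_test (\<psi> n)" "\<And>n. flat_test (\<lambda>x. vfield x * deriv (\<psi> n) x)"
      "\<And>n x. \<bar>\<psi> n x\<bar> \<le> 1" "\<And>x. (\<lambda>n. \<psi> n x) \<longlonglongrightarrow> indicator ({a<..} - {1}) x"
    have [measurable]: "\<psi> n \<in> borel_measurable borel" for n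
      using flat_test_measurable(1)[OF \<psi>(1)] .
    have lim: "(\<lambda>n. LBINT x. \<psi> n x * h x) \<longlonglongrightarrow> (LBINT x. indicator ({a<..} - {1}) x * h x)"
      if h: "integrable lborel h" for h :: "real \<Rightarrow> real"
    proof (rule integral_dominated_convergence[where w = "\<lambda>x. \<bar>h x\<bar>"])
      have [measurable]: "h \<in> borel_measurable borel" using h by simp
      show "(\<lambda>x. indicator ({a<..} - {1}) x * h x) \<in> borel_measurable lborel"
        "(\<lambda>x. \<psi> n x * h x) \<in> borel_measurable lborel" for n by measurable
      show "AE x in lborel. (\<lambda>n. \<psi> n x * h x) \<longlonglongrightarrow> indicator ({a<..} - {1}) x * h x"
        by (intro AE_I2 tendsto_mult \<psi>(4) tendsto_const)
      show "AE x in lborel. norm (\<psi> n x * h x) \<le> \<bar>h x\<bar>" for n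
        using \<psi>(3) by (intro AE_I2) (simp add: abs_mult mult_left_le_one_le)
    qed (use h in simp)
    show ?thesis
      using lim[OF fD(1)] lim[OF gD(1)] LIMSEQ_unique unfolding eq[OF \<psi>(1,2)] by blast
  qed
  then have "density lborel (\<lambda>x. ennreal (f x)) = density lborel (\<lambda>x. ennreal (g x))"
    by (intro measure_eqI_lessThan) (simp_all add: tail[OF fD] tail[OF gD])
  then have "AE x in lborel. ennreal (f x) = ennreal (g x)"
    
    using sigma_finite_measure.density_unique_iff[OF lborel.sigma_finite_measure_axioms,
        of "\<lambda>x. ennreal (f x)" "\<lambda>x. ennreal (g x)"] by simp
  then show ?thesis
    using fD(2) gD(2) by (auto elim!: eventually_mono)
qed

text \<open>By \<open>weak_solution_transport\<close>, the pairing of either solution with a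
  suitable \<open>\<psi>\<close> equals one and the same integral, in which only \<open>f\<close>
  and the flow occur.\<close>

lemma unique_weak_solution_loglin_density:
  assumes "prob_density f"
  shows "unique_weak_solution vfield f (loglin_density f)"
  unfolding unique_weak_solution_def
proof (intro conjI allI impI)
  show ws: "weak_solution vfield f (loglin_density f)"
    by (rule weak_solution_loglin_density[OF assms])
  fix \<sigma> and t :: real
  assume \<sigma>: "weak_solution vfield f \<sigma>" and t: "0 \<le> t"
  show "AE x in lborel. \<sigma> t x = loglin_density f t x"
  proof (rule prob_density_eqI)
    show "prob_density (\<sigma> t)" "prob_density (loglin_density f t)"
      using \<sigma> ws t by (auto simp: weak_solution_def)
    fix \<psi> assume \<psi>: "flat_test \<psi>" "flat_test (\<lambda>x. vfield x * deriv \<psi> x)"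
    show "(LBINT x. \<psi> x * \<sigma> t x) = (LBINT x. \<psi> x * loglin_density f t x)"
      unfolding weak_solution_transport[OF \<sigma> \<psi>(1) \<psi>(2) _ t, OF refl]
        weak_solution_transport[OF ws \<psi>(1) \<psi>(2) _ t, OF refl] ..
  qed
qed

section \<open>The tail at the critical time\<close>

lemma rhoB_ratio_tendsto:
  assumes "0 < q" "q \<le> p"
  shows "\<exists>L. ((\<lambda>x. loglin_density (rhoB p) (ln (p / q)) x / rhoB q x) \<longlongrightarrow> L) at_top"
proof -
  define Zp where "Zp = (LBINT y. exp (- (\<bar>y\<bar> powr p)))"
  define Zq where "Zq = (LBINT y. exp (- (\<bar>y\<bar> powr q)))"
  \<comment> \<open>The quotient of the normalising factors times \<open>exp (- T) = q / p\<close>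
    from the Jacobian, where \<open>T = ln (p / q)\<close>.\<close>
  define c where "c = inverse Zp / inverse Zq * (q / p)"
  have p: "0 < p" using assms by simp
  have eT: "exp (- ln (p / q)) = q / p" using assms p by (simp add: exp_minus)
  have ratio: "loglin_density (rhoB p) (ln (p / q)) x / rhoB q x = c * x powr (q / p - 1)" if x: "1 < x" for x
  proof -
    have \<Phi>: "loglin_flow (- ln (p / q)) x = x powr (q / p)"
      using x eT by (simp add: loglin_flow_def powr_def)
    \<comment> \<open>This is what singles out \<open>T\<close>: the two exponentials cancel exactly
      and only a power of \<open>x\<close> remains.\<close>
    have pw: "(x powr (q / p)) powr p = x powr q"
      using p by (simp add: powr_powr)
    have "loglin_density (rhoB p) (ln (p / q)) x =
        exp (- (x powr q)) / Zp * (q / p * x powr (q / p) / x)"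
      using x by (simp add: loglin_density_def \<Phi> eT rhoB_def pw Zp_def)
    moreover have "rhoB q x = exp (- (x powr q)) / Zq"
      using x by (simp add: rhoB_def Zq_def)
    moreover have "x powr (q / p - 1) = x powr (q / p) / x"
      using x by (simp add: powr_diff)
    ultimately show ?thesis by (simp add: c_def field_simps)
  qed
  have "\<exists>L. ((\<lambda>x::real. c * x powr (q / p - 1)) \<longlongrightarrow> L) at_top"
  proof (cases "q = p")
    case True
    have "((\<lambda>x::real. c * x powr (q / p - 1)) \<longlongrightarrow> c) at_top"
      \<comment> \<open>The exponent is 0, and \<open>x powr 0 = 1\<close> for nonzero
        \<open>x\<close>, hence the restriction to large \<open>x\<close>.\<close>
      by (rule tendsto_eventually) (use True p in \<open>auto intro!: eventually_mono[OF eventually_gt_at_top[of 0]]\<close>)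
    then show ?thesis by blast
  next
    case False
    then have "q / p - 1 < 0" using assms p by (simp add: field_simps)
    then have "((\<lambda>x::real. x powr (q / p - 1)) \<longlongrightarrow> 0) at_top"
      by (intro tendsto_neg_powr filterlim_ident)
    then have "((\<lambda>x::real. c * x powr (q / p - 1)) \<longlongrightarrow> c * 0) at_top"
      by (rule tendsto_mult_left)
    then show ?thesis by blast
  qed
  then obtain L where "((\<lambda>x::real. c * x powr (q / p - 1)) \<longlongrightarrow> L) at_top" by blast
  then have "((\<lambda>x. loglin_density (rhoB p) (ln (p / q)) x / rhoB q x) \<longlongrightarrow> L) at_top"
    by (rule Lim_transform_eventually)
       (auto intro!: eventually_mono[OF eventually_gt_at_top[of 1]] simp: ratio)
  then show ?thesis by blast
qed

text \<open>For \<open>q = p\<close> the time is \<open>ln 1 = 0\<close>, and no positive time would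
  do: the tail exponent at time \<open>T\<close> is \<open>p * exp (- T) < p\<close>, so the ratio
  to \<open>rhoB p\<close> diverges. Continuity on \<open>{1<..}\<close> fixes the representative
  there, which gives the pointwise limit its meaning.\<close>

theorem proposition1p6:
  fixes p :: real
  assumes "p > 0"
  shows "\<exists>\<rho> :: real \<Rightarrow> real \<Rightarrow> real.
           unique_weak_solution vfield (rhoB p) \<rho> \<and>
           given_by_characteristics vfield (rhoB p) \<rho> \<and>
           (\<forall>t\<ge>0. continuous_on {1<..} (\<rho> t)) \<and>
           (\<forall>q\<in>{0<..p}. \<exists>T\<ge>0. (q < p \<longrightarrow> T > 0) \<and>
              (\<exists>L :: real. ((\<lambda>x. \<rho> T x / rhoB q x) \<longlongrightarrow> L) at_top))"
proof (intro exI[of _ "loglin_density (rhoB p)"] conjI)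
  have pd: "prob_density (rhoB p)" by (rule prob_density_rhoB[OF assms])
  then have f: "integrable lborel (rhoB p)" "\<And>x. 0 \<le> rhoB p x"
    by (auto simp: prob_density_def)
  show "unique_weak_solution vfield (rhoB p) (loglin_density (rhoB p))"
    by (rule unique_weak_solution_loglin_density[OF pd])
  show "given_by_characteristics vfield (rhoB p) (loglin_density (rhoB p))"
    unfolding given_by_characteristics_def
    using is_flow_loglin_flow density_loglin_density[OF f]
    by (intro exI[of _ loglin_flow]) simp
  show "\<forall>t\<ge>0. continuous_on {1<..} (loglin_density (rhoB p) t)"
    using continuous_on_loglin_density[OF continuous_on_rhoB[OF assms]] by blast
  show "\<forall>q\<in>{0<..p}. \<exists>T\<ge>0. (q < p \<longrightarrow> T > 0) \<and>
      (\<exists>L :: real. ((\<lambda>x. loglin_density (rhoB p) T x / rhoB q x) \<longlongrightarrow> L) at_top)"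
  proof
    fix q assume q: "q \<in> {0<..p}"
    then show "\<exists>T\<ge>0. (q < p \<longrightarrow> T > 0) \<and>
        (\<exists>L :: real. ((\<lambda>x. loglin_density (rhoB p) T x / rhoB q x) \<longlongrightarrow> L) at_top)"
      using rhoB_ratio_tendsto[of q p] by (intro exI[of _ "ln (p / q)"]) auto
  qed
qed

end
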